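(* The group $\mathrm{Homeo}_c(\mathbb{R})$ has commuting $\mathbb{Z}$-conjugates but does not have commuting $\mathbb{Z}/n$-conjugates for any integer $n \geq 2$.
   Context: $\mathrm{Homeo}_c(\mathbb{R})$ denotes the group (viewed as a discrete group) of compactly supported homeomorphisms of $\mathbb{R}$. We write ${}^t H = tHt^{-1}$. A group $\Gamma$ has *commuting $\mathbb{Z}$-conjugates* if for every finitely generated subgroup $H \leq \Gamma$ there exists $t \in \Gamma$ such that $[H, {}^{t^p} H] = 1$ for all integers $p \geq 1$. For an integer $n \geq 2$, $\Gamma$ has *commuting $\mathbb{Z}/n$-conjugates* if for every finitely generated subgroup $H \leq \Gamma$ there exists $t \in \Gamma$ such that $[H, {}^{t^p} H] = 1$ for all $1 \leq p < n$, and $[H, t^n] = 1$. *)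

theory Defs
  imports "HOL-Analysis.Analysis" "HOL-Algebra.Coset" "HOL-Algebra.Generated_Groups"
begin

definition commutator_subgroup :: "('a, 'b) monoid_scheme \<Rightarrow> 'a set \<Rightarrow> 'a set \<Rightarrow> 'a set"
  where "commutator_subgroup G A B =
    generate G (\<Union>a\<in>A. \<Union>b\<in>B. {a \<otimes>\<^bsub>G\<^esub> b \<otimes>\<^bsub>G\<^esub> inv\<^bsub>G\<^esub> a \<otimes>\<^bsub>G\<^esub> inv\<^bsub>G\<^esub> b})"

definition conjugate :: "('a, 'b) monoid_scheme \<Rightarrow> 'a \<Rightarrow> 'a set \<Rightarrow> 'a set"
  where "conjugate G t H = t <#\<^bsub>G\<^esub> H #>\<^bsub>G\<^esub> inv\<^bsub>G\<^esub> t"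

definition finitely_generated_subgroup :: "'a set \<Rightarrow> ('a, 'b) monoid_scheme \<Rightarrow> bool"
  where "finitely_generated_subgroup H G \<longleftrightarrow>
    subgroup H G \<and> (\<exists>S. finite S \<and> S \<subseteq> carrier G \<and> H = generate G S)"

definition commuting_Z_conjugates :: "('a, 'b) monoid_scheme \<Rightarrow> bool"
  where "commuting_Z_conjugates G \<longleftrightarrow>
    (\<forall>H. finitely_generated_subgroup H G \<longrightarrow>
      (\<exists>t\<in>carrier G. \<forall>p::nat. 1 \<le> p \<longrightarrow>
        commutator_subgroup G H (conjugate G (t [^]\<^bsub>G\<^esub> p) H) = {\<one>\<^bsub>G\<^esub>}))"

definition commuting_Zmod_conjugates :: "('a, 'b) monoid_scheme \<Rightarrow> nat \<Rightarrow> bool"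
  where "commuting_Zmod_conjugates G n \<longleftrightarrow>
    (\<forall>H. finitely_generated_subgroup H G \<longrightarrow>
      (\<exists>t\<in>carrier G.
        (\<forall>p::nat. 1 \<le> p \<and> p < n \<longrightarrow>
          commutator_subgroup G H (conjugate G (t [^]\<^bsub>G\<^esub> p) H) = {\<one>\<^bsub>G\<^esub>}) \<and>
        commutator_subgroup G H {t [^]\<^bsub>G\<^esub> n} = {\<one>\<^bsub>G\<^esub>}))"

definition Homeo_c :: "(real \<Rightarrow> real) monoid"
  where "Homeo_c =
    \<lparr>carrier = {f. (\<exists>g. homeomorphism UNIV UNIV f g) \<and> compact (closure {x. f x \<noteq> x})},
     mult = (\<circ>), one = id\<rparr>"

lemma group_Homeo_c: "group Homeo_c"
proof (rule groupI)
  fix f g assume "f \<in> carrier Homeo_c" "g \<in> carrier Homeo_c"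
  then obtain f' g' where f: "homeomorphism UNIV UNIV f f'" "bounded {x. f x \<noteq> x}"
    and g: "homeomorphism UNIV UNIV g g'" "bounded {x. g x \<noteq> x}"
    by (auto simp: Homeo_c_def)
  have "bounded {x. (f \<circ> g) x \<noteq> x}"
    by (rule bounded_subset[of "{x. f x \<noteq> x} \<union> {x. g x \<noteq> x}"]) (use f g in auto)
  then show "f \<otimes>\<^bsub>Homeo_c\<^esub> g \<in> carrier Homeo_c"
    using homeomorphism_compose[OF g(1) f(1)] by (auto simp: Homeo_c_def)
next
  show "\<one>\<^bsub>Homeo_c\<^esub> \<in> carrier Homeo_c"
    using homeomorphism_ident[of "UNIV :: real set"] by (auto simp: Homeo_c_def id_def)
next
  fix f assume "f \<in> carrier Homeo_c"
  then obtain f' where f: "homeomorphism UNIV UNIV f f'" "bounded {x. f x \<noteq> x}"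
    by (auto simp: Homeo_c_def)
  have inv: "f' (f x) = x" "f (f' x) = x" for x
    using f(1) by (auto simp: homeomorphism_def)
  have "{x. f' x \<noteq> x} \<subseteq> {x. f x \<noteq> x}"
    using inv by (metis (mono_tags, lifting) Collect_mono)
  then have "f' \<in> carrier Homeo_c"
    using homeomorphism_symD[OF f(1)] bounded_subset[OF f(2)] by (auto simp: Homeo_c_def)
  moreover have "f' \<circ> f = id" using inv by auto
  ultimately show "\<exists>g\<in>carrier Homeo_c. g \<otimes>\<^bsub>Homeo_c\<^esub> f = \<one>\<^bsub>Homeo_c\<^esub>"
    by (auto simp: Homeo_c_def)
qed (auto simp: Homeo_c_def comp_assoc)

end

(* Commuting Z-conjugates: finitely many compactly supported homeomorphisms are all supported in
   one interval {-a..a}, and a homeomorphism t with t x \<ge> x and t (- a) > a pushes this interval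
   off itself under every positive power.

   No commuting Z/n-conjugates: take H generated by k and h, where 1 is the supremum of the set
   of points moved by k and h 1 \<noteq> 1.  If t^n commutes with k, then t^n fixes 1, and so does t,
   since compactly supported homeomorphisms are increasing.  Hence 1 is also the supremum of the
   set of points moved by t k t^-1, and h, which commutes with t k t^-1, must fix 1. *)

theory Submission
  imports Defs
begin

text \<open>A generated subgroup is trivial exactly when all its generators are, so both
  commuting-conjugates properties reduce to equations between elements.\<close>

lemma (in group) commutator_subgroup_trivial_iff:
  assumes "A \<subseteq> carrier G" "B \<subseteq> carrier G"
  shows "commutator_subgroup G A B = {\<one>} \<longleftrightarrow> (\<forall>a\<in>A. \<forall>b\<in>B. a \<otimes> b = b \<otimes> a)"
proof -
  have comm: "a \<otimes> b \<otimes> inv a \<otimes> inv b = \<one> \<longleftrightarrow> a \<otimes> b = b \<otimes> a"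
    if "a \<in> carrier G" "b \<in> carrier G" for a b
  proof -
    have "a \<otimes> b \<otimes> inv a \<otimes> inv b = (a \<otimes> b) \<otimes> inv (b \<otimes> a)"
      using that by (simp add: m_assoc inv_mult_group)
    then show ?thesis
      using that by (simp add: inv_solve_right')
  qed
  let ?C = "\<Union>a\<in>A. \<Union>b\<in>B. {a \<otimes> b \<otimes> inv a \<otimes> inv b}"
  have "generate G ?C = {\<one>} \<longleftrightarrow> ?C \<subseteq> {\<one>}"
  proof
    assume "generate G ?C = {\<one>}"
    moreover have "?C \<subseteq> generate G ?C" by (rule subsetI) (rule generate.incl)
    ultimately show "?C \<subseteq> {\<one>}" by simp
  next
    assume "?C \<subseteq> {\<one>}"
    then have "generate G ?C \<subseteq> generate G {\<one>}" by (rule mono_generate)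
    then have "generate G ?C \<subseteq> {\<one>}" by (simp add: generate_one)
    moreover have "\<one> \<in> generate G ?C" by (rule generate.one)
    ultimately show "generate G ?C = {\<one>}" by (intro subset_antisym) simp_all
  qed
  also have "\<dots> \<longleftrightarrow> (\<forall>a\<in>A. \<forall>b\<in>B. a \<otimes> b \<otimes> inv a \<otimes> inv b = \<one>)" by blast
  also have "\<dots> \<longleftrightarrow> (\<forall>a\<in>A. \<forall>b\<in>B. a \<otimes> b = b \<otimes> a)"
    using comm assms by (intro ball_cong refl) blast
  finally show ?thesis unfolding commutator_subgroup_def .
qed

lemma conjugate_eq:
  "conjugate G t H = (\<lambda>h. t \<otimes>\<^bsub>G\<^esub> h \<otimes>\<^bsub>G\<^esub> inv\<^bsub>G\<^esub> t) ` H"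
  by (auto simp: conjugate_def l_coset_def r_coset_def)

section \<open>Basic properties of compactly supported homeomorphisms\<close>

interpretation Homeo_c: group Homeo_c
  by (rule group_Homeo_c)

lemma mult_Homeo_c [simp]: "f \<otimes>\<^bsub>Homeo_c\<^esub> g = f \<circ> g"
  and one_Homeo_c [simp]: "\<one>\<^bsub>Homeo_c\<^esub> = id"
  by (simp_all add: Homeo_c_def)

lemma pow_Homeo_c [simp]: "f [^]\<^bsub>Homeo_c\<^esub> (n::nat) = f ^^ n"
  by (induction n) (simp_all add: funpow_Suc_right del: funpow.simps(2))

lemma mem_Homeo_c_iff:
  "f \<in> carrier Homeo_c \<longleftrightarrow> (\<exists>g. homeomorphism UNIV UNIV f g) \<and> bounded {x. f x \<noteq> x}"
  by (simp add: Homeo_c_def)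

lemma continuous_Homeo_c: "f \<in> carrier Homeo_c \<Longrightarrow> continuous_on UNIV f"
  by (auto simp: mem_Homeo_c_iff homeomorphism_def)

lemma bij_Homeo_c: "f \<in> carrier Homeo_c \<Longrightarrow> bij f"
  by (metis mem_Homeo_c_iff homeomorphism_def bij_betw_def UNIV_I inj_on_inverseI)

lemma funpow_Homeo_c: "f \<in> carrier Homeo_c \<Longrightarrow> f ^^ n \<in> carrier Homeo_c"
  using Homeo_c.nat_pow_closed[of f n] by simp

lemma inv_Homeo_c:
  assumes "f \<in> carrier Homeo_c"
  shows "(inv\<^bsub>Homeo_c\<^esub> f) (f x) = x" "f ((inv\<^bsub>Homeo_c\<^esub> f) x) = x"
  using Homeo_c.l_inv[OF assms] Homeo_c.r_inv[OF assms] by (auto simp: fun_eq_iff)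

text \<open>A continuous injection is strictly monotone on each interval. An interval whose
  endpoints are both fixed rules out the decreasing case.\<close>

lemma strict_mono_Homeo_c:
  assumes f: "f \<in> carrier Homeo_c"
  shows "strict_mono f"
proof -
  obtain a where a: "\<And>x. f x \<noteq> x \<Longrightarrow> \<bar>x\<bar> \<le> a"
    using f by (auto simp: mem_Homeo_c_iff bounded_iff)
  show ?thesis
  proof (rule strict_monoI)
    fix x y :: real
    assume xy: "x < y"
    \<comment> \<open>Large enough that \<open>x\<close> and \<open>y\<close> lie inside
      \<open>{- b..b}\<close>, while \<open>b\<close> and \<open>- b\<close> lie outside the
      support.\<close>
    define b where "b = \<bar>x\<bar> + \<bar>y\<bar> + \<bar>a\<bar> + 1"
    have b: "x < b" "y < b" "- b < x" "- b < y" "a < b" "0 < b"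
      unfolding b_def by linarith+
    have fix_b: "f b = b" "f (- b) = - b" using a[of b] a[of "- b"] b by auto
    have "continuous_on {- b..b} f" "inj_on f {- b..b}"
      using continuous_Homeo_c[OF f] bij_Homeo_c[OF f]
      by (auto intro: continuous_on_subset inj_on_subset simp: bij_def)
    moreover have "is_interval {- b..b}" by simp
    ultimately have "strict_mono_on {- b..b} f \<or> strict_antimono_on {- b..b} f"
      using injective_eq_monotone_map by blast
    moreover have "\<not> strict_antimono_on {- b..b} f"
    proof
      assume "strict_antimono_on {- b..b} f"
      then have "f b < f (- b)" using b(6) by (auto simp: monotone_on_def)
      then show False using b(6) fix_b by simp
    qed
    ultimately show "f x < f y"
      using b xy by (auto simp: monotone_on_def)
  qed
qed

section \<open>Sets of moved points, their suprema, and fixed points of iterates\<close>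

lemma image_moved:
  assumes "bij f" "f \<circ> g = g' \<circ> f"
  shows "f ` {x. g x \<noteq> x} = {x. g' x \<noteq> x}"
proof -
  have eq: "g' (f x) = f (g x)" for x using assms(2) by (metis comp_apply)
  show ?thesis
  proof (rule subset_antisym; rule subsetI)
    fix y
    assume "y \<in> f ` {x. g x \<noteq> x}"
    then show "y \<in> {x. g' x \<noteq> x}" using eq \<open>bij f\<close> by (auto simp: bij_def inj_eq)
  next
    fix y
    assume "y \<in> {x. g' x \<noteq> x}"
    moreover obtain x where "y = f x" using \<open>bij f\<close> by (metis bij_pointE)
    ultimately show "y \<in> f ` {x. g x \<noteq> x}" using eq by auto
  qed
qed

text \<open>An increasing continuous map preserves suprema of nonempty sets that are bounded above.
  Writing the conjugation as \<open>f \<circ> g = g' \<circ> f\<close> covers two uses: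
  \<open>g' = g\<close> when the maps commute, and \<open>g'\<close> the conjugate of
  \<open>g\<close> by \<open>f\<close>.\<close>

lemma Sup_moved:
  assumes f: "f \<in> carrier Homeo_c" and g: "g \<in> carrier Homeo_c" "g \<noteq> id"
    and fg: "f \<circ> g = g' \<circ> f"
  shows "f (Sup {x. g x \<noteq> x}) = Sup {x. g' x \<noteq> x}"
proof -
  let ?S = "{x. g x \<noteq> x}"
  have "?S \<noteq> {}" using g(2) by (auto simp: fun_eq_iff)
  moreover have "bdd_above ?S" using g(1) by (simp add: mem_Homeo_c_iff bounded_imp_bdd_above)
  moreover have "continuous (at_left (Sup ?S)) f"
    using continuous_Homeo_c[OF f]
    by (metis UNIV_I continuous_at_imp_continuous_at_within continuous_on_eq_continuous_at open_UNIV)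
  ultimately have "f (Sup ?S) = Sup (f ` ?S)"
    using continuous_at_Sup_mono strict_mono_mono strict_mono_Homeo_c[OF f] by blast
  then show ?thesis using image_moved[OF bij_Homeo_c[OF f] fg] by simp
qed

text \<open>If \<open>x < f x\<close>, monotonicity carries this along the orbit, so every positive
  iterate stays strictly above \<open>x\<close>; the case \<open>f x < x\<close> is
  symmetric.\<close>

lemma fixed_point_of_funpow:
  fixes f :: "'a::linorder \<Rightarrow> 'a"
  assumes f: "strict_mono f" and fixed: "(f ^^ n) x = x" and "0 < n"
  shows "f x = x"
proof (rule ccontr)
  assume "f x \<noteq> x"
  then consider "x < f x" | "f x < x" by force
  then show False
  proof cases
    case 1
    have "x < (f ^^ Suc m) x" for m
      by (induction m) (use 1 f in \<open>auto dest: strict_monoD intro: less_trans\<close>)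
    then show False using fixed \<open>0 < n\<close> by (metis gr0_conv_Suc less_irrefl)
  next
    case 2
    have "(f ^^ Suc m) x < x" for m
      by (induction m) (use 2 f in \<open>auto dest: strict_monoD intro: less_trans\<close>)
    then show False using fixed \<open>0 < n\<close> by (metis gr0_conv_Suc less_irrefl)
  qed
qed

section \<open>An explicit homeomorphism supported in an interval\<close>

text \<open>Between its fixed points \<open>u\<close> and \<open>v\<close> the graph follows the line of slope 4 through
  \<open>(u, u)\<close> and then the line of slope 1/4 through \<open>(v, v)\<close>.\<close>

definition push :: "real \<Rightarrow> real \<Rightarrow> real \<Rightarrow> real"
  where "push u v x = max x (min (u + 4 * (x - u)) (v + (x - v) / 4))"

lemma push_ge: "x \<le> push u v x"
  by (simp add: push_def)

lemma moved_push:
  assumes "u < v"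
  shows "{x. push u v x \<noteq> x} = {u<..<v}"
  using assms by (auto simp: push_def max_def min_def field_simps split: if_splits)

lemma push_Homeo_c:
  assumes "u < v"
  shows "push u v \<in> carrier Homeo_c"
proof -
  \<comment> \<open>The inverse of \<open>push u v\<close>: each of the three lines is replaced by
    its inverse, and \<open>max\<close> and \<open>min\<close> change places because the graph is
    reflected in the diagonal.\<close>
  define g where "g y = min y (max (u + (y - u) / 4) (v + 4 * (y - v)))" for y
  have "g (push u v x) = x" "push u v (g x) = x" for x
    unfolding push_def g_def min_def max_def using assms by (auto simp: field_simps)
  moreover have "continuous_on UNIV (push u v)" "continuous_on UNIV g"
    unfolding push_def[abs_def] g_def[abs_def] by (intro continuous_intros; simp)+
  ultimately have "homeomorphism UNIV UNIV (push u v) g"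
    by (intro homeomorphismI) auto
  then show ?thesis
    using moved_push[OF assms] by (auto simp: mem_Homeo_c_iff)
qed

section \<open>Supports and commutation\<close>

lemma subgroup_supported:
  "subgroup {f \<in> carrier Homeo_c. \<forall>x. x \<notin> K \<longrightarrow> f x = x} Homeo_c"
proof (rule Homeo_c.subgroupI)
  show "{f \<in> carrier Homeo_c. \<forall>x. x \<notin> K \<longrightarrow> f x = x} \<noteq> {}"
    using Homeo_c.one_closed by force
next
  fix f g
  assume "f \<in> {f \<in> carrier Homeo_c. \<forall>x. x \<notin> K \<longrightarrow> f x = x}"
    and "g \<in> {f \<in> carrier Homeo_c. \<forall>x. x \<notin> K \<longrightarrow> f x = x}"
  then show "f \<otimes>\<^bsub>Homeo_c\<^esub> g \<in> {f \<in> carrier Homeo_c. \<forall>x. x \<notin> K \<longrightarrow> f x = x}"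
    using Homeo_c.m_closed[of f g] by auto
next
  fix f
  assume "f \<in> {f \<in> carrier Homeo_c. \<forall>x. x \<notin> K \<longrightarrow> f x = x}"
  then show "inv\<^bsub>Homeo_c\<^esub> f \<in> {f \<in> carrier Homeo_c. \<forall>x. x \<notin> K \<longrightarrow> f x = x}"
    by simp (metis inv_Homeo_c(1))
qed auto

text \<open>Finitely many bounded supports have a bounded union, and the maps fixing every point
  outside a given set form a subgroup, so a bound for the generators holds on all of
  \<open>H\<close>.\<close>

lemma finitely_generated_support:
  assumes "finitely_generated_subgroup H Homeo_c"
  obtains a where "0 < a" "\<And>f x. f \<in> H \<Longrightarrow> x \<notin> {-a..a} \<Longrightarrow> f x = x"
proof -
  obtain S where S: "finite S" "S \<subseteq> carrier Homeo_c" "H = generate Homeo_c S"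
    using assms by (auto simp: finitely_generated_subgroup_def)
  have "bounded (\<Union>f\<in>S. {x. f x \<noteq> x})"
    using S by (intro bounded_UN) (auto simp: mem_Homeo_c_iff)
  then obtain a where a: "0 < a" "\<And>f x. f \<in> S \<Longrightarrow> f x \<noteq> x \<Longrightarrow> \<bar>x\<bar> \<le> a"
    by (auto simp: bounded_pos)
  have "S \<subseteq> {f \<in> carrier Homeo_c. \<forall>x. x \<notin> {-a..a} \<longrightarrow> f x = x}"
    using S(2) a(2) by (force simp: abs_le_iff)
  then have "H \<subseteq> {f \<in> carrier Homeo_c. \<forall>x. x \<notin> {-a..a} \<longrightarrow> f x = x}"
    unfolding S(3) by (intro Homeo_c.generate_subgroup_incl subgroup_supported)
  then show thesis using that a(1) by blast
qed

text \<open>By injectivity \<open>f\<close> maps \<open>K\<close> into itself: if \<open>f x\<close>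
  were outside \<open>K\<close>, then \<open>f (f x) = f x\<close> would give
  \<open>f x = x\<close>. Likewise \<open>g\<close> preserves the complement of
  \<open>K\<close>.\<close>

lemma commute_if_disjoint_supports:
  assumes "inj f" "inj g"
    and f: "\<And>x. x \<notin> K \<Longrightarrow> f x = x" and g: "\<And>x. x \<in> K \<Longrightarrow> g x = x"
  shows "f \<circ> g = g \<circ> f"
proof
  fix x
  show "(f \<circ> g) x = (g \<circ> f) x"
    using assms by (cases "x \<in> K") (metis comp_apply injD)+
qed

section \<open>Commuting conjugates under all positive powers\<close>

lemma commuting_Z_conjugates_Homeo_c: "commuting_Z_conjugates Homeo_c"
  unfolding commuting_Z_conjugates_def
proof (intro allI impI)
  fix H
  assume fg: "finitely_generated_subgroup H Homeo_c"
  then obtain a where a: "0 < a" and supp: "\<And>f x. f \<in> H \<Longrightarrow> x \<notin> {-a..a} \<Longrightarrow> f x = x"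
    using finitely_generated_support by blast
  have H: "H \<subseteq> carrier Homeo_c"
    using fg by (auto simp: finitely_generated_subgroup_def subgroup_def)
  \<comment> \<open>With these endpoints \<open>t (- a) = 5 * a / 4\<close>, which exceeds
    \<open>a\<close>.\<close>
  define t where "t = push (- 2 * a) (2 * a)"
  have t: "t \<in> carrier Homeo_c" unfolding t_def using a by (intro push_Homeo_c) simp
  have away: "(t ^^ p) x > a" if "1 \<le> p" "- a \<le> x" for p x
    using that(1)
  proof (induction p rule: dec_induct)
    case base
    show ?case using a that(2) by (simp add: t_def push_def less_max_iff_disj field_simps)
  next
    case (step p)
    then show ?case using push_ge[of "(t ^^ p) x"] unfolding t_def by (simp add: less_le_trans)
  qed
  have "commutator_subgroup Homeo_c H (conjugate Homeo_c (t [^]\<^bsub>Homeo_c\<^esub> p) H) = {\<one>\<^bsub>Homeo_c\<^esub>}"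
    if p: "1 \<le> p" for p :: nat
  proof -
    let ?s = "t ^^ p"
    have s: "?s \<in> carrier Homeo_c" by (rule funpow_Homeo_c[OF t])
    have conj: "?s \<circ> h \<circ> inv\<^bsub>Homeo_c\<^esub> ?s \<in> carrier Homeo_c" if "h \<in> H" for h
      using that s H Homeo_c.m_closed Homeo_c.inv_closed by (metis mult_Homeo_c subsetD)
    have "f \<circ> (?s \<circ> h \<circ> inv\<^bsub>Homeo_c\<^esub> ?s) = (?s \<circ> h \<circ> inv\<^bsub>Homeo_c\<^esub> ?s) \<circ> f"
      if fh: "f \<in> H" "h \<in> H" for f h
    proof (rule commute_if_disjoint_supports[where K = "{-a..a}"])
      fix x
      assume x: "x \<in> {-a..a}"
      \<comment> \<open>Were the preimage of \<open>x\<close> at least \<open>- a\<close>, then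
        \<open>away\<close> would put \<open>x\<close> itself above \<open>a\<close>.\<close>
      have "(inv\<^bsub>Homeo_c\<^esub> ?s) x \<notin> {-a..a}"
        using away[OF p, of "(inv\<^bsub>Homeo_c\<^esub> ?s) x"] x inv_Homeo_c(2)[OF s] by auto
      then show "(?s \<circ> h \<circ> inv\<^bsub>Homeo_c\<^esub> ?s) x = x"
        using supp[OF fh(2)] inv_Homeo_c(2)[OF s] by simp
    qed (use fh H conj supp bij_Homeo_c in \<open>auto simp: bij_def\<close>)
    moreover have "conjugate Homeo_c ?s H \<subseteq> carrier Homeo_c"
      using conj by (auto simp: conjugate_eq)
    ultimately show ?thesis
      using Homeo_c.commutator_subgroup_trivial_iff[OF H] by (simp add: conjugate_eq)
  qed
  with t show "\<exists>t\<in>carrier Homeo_c. \<forall>p::nat. 1 \<le> p \<longrightarrow>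
      commutator_subgroup Homeo_c H (conjugate Homeo_c (t [^]\<^bsub>Homeo_c\<^esub> p) H) = {\<one>\<^bsub>Homeo_c\<^esub>}"
    by blast
qed

section \<open>Failure for finite cyclic groups\<close>

lemma not_commuting_Zmod_conjugates_Homeo_c:
  assumes n: "2 \<le> n"
  shows "\<not> commuting_Zmod_conjugates Homeo_c n"
proof
  assume comm: "commuting_Zmod_conjugates Homeo_c n"
  \<comment> \<open>The right end 1 of the interval moved by \<open>k\<close> lies inside the
    interval \<open>{0<..<2}\<close> moved by \<open>h\<close>.\<close>
  define h k where "h = push 0 2" and "k = push 0 1"
  have h: "h \<in> carrier Homeo_c" and k: "k \<in> carrier Homeo_c"
    unfolding h_def k_def by (simp_all add: push_Homeo_c)
  have Sup_k: "Sup {x. k x \<noteq> x} = 1" unfolding k_def by (simp add: moved_push)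
  have "k (1 / 2) \<noteq> 1 / 2" by (simp add: k_def push_def)
  then have k_id: "k \<noteq> id" by auto
  define H where "H = generate Homeo_c {h, k}"
  have hk: "h \<in> H" "k \<in> H" unfolding H_def by (auto intro: generate.incl)
  have "subgroup H Homeo_c"
    unfolding H_def using h k by (intro Homeo_c.generate_is_subgroup) auto
  then have H: "H \<subseteq> carrier Homeo_c" by (rule subgroup.subset)
  have "finitely_generated_subgroup H Homeo_c"
    unfolding finitely_generated_subgroup_def
    using \<open>subgroup H Homeo_c\<close> h k by (auto simp: H_def intro!: exI[of _ "{h, k}"])
  \<comment> \<open>The exponent 1 is admissible because \<open>1 < n\<close>.\<close>
  then obtain t where t: "t \<in> carrier Homeo_c"
    and conj: "commutator_subgroup Homeo_c H (conjugate Homeo_c (t ^^ 1) H) = {\<one>\<^bsub>Homeo_c\<^esub>}"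
    and pow: "commutator_subgroup Homeo_c H {t ^^ n} = {\<one>\<^bsub>Homeo_c\<^esub>}"
    using comm n unfolding commuting_Zmod_conjugates_def pow_Homeo_c by force
  let ?k' = "t \<circ> k \<circ> inv\<^bsub>Homeo_c\<^esub> t"
  have k': "?k' \<in> carrier Homeo_c"
    using t k Homeo_c.m_closed Homeo_c.inv_closed by (metis mult_Homeo_c)
  have tk: "t \<circ> k = ?k' \<circ> t" using inv_Homeo_c(1)[OF t] by (simp add: fun_eq_iff)
  have "(t ^^ n) \<circ> k = k \<circ> (t ^^ n)"
    using pow hk(2) Homeo_c.commutator_subgroup_trivial_iff[OF H, of "{t ^^ n}"] funpow_Homeo_c[OF t]
    by simp
  then have "(t ^^ n) 1 = 1"
    using Sup_moved[OF funpow_Homeo_c[OF t] k k_id] Sup_k by metis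
  then have "t 1 = 1"
    using fixed_point_of_funpow strict_mono_Homeo_c[OF t] n by (metis less_le_trans pos2)
  then have Sup_k': "Sup {x. ?k' x \<noteq> x} = 1"
    using Sup_moved[OF t k k_id tk] Sup_k by metis
  \<comment> \<open>This makes the set of points moved by the conjugate nonempty, so that
    \<open>Sup_moved\<close> applies to it.\<close>
  have k'_id: "?k' \<noteq> id"
  proof
    assume "?k' = id"
    then have "t (k x) = t x" for x using tk by (metis comp_apply id_apply)
    then show False using k_id bij_Homeo_c[OF t] by (auto simp: bij_def inj_eq)
  qed
  have "conjugate Homeo_c t H \<subseteq> carrier Homeo_c"
    using t H Homeo_c.m_closed Homeo_c.inv_closed
    by (auto simp: conjugate_eq simp flip: mult_Homeo_c simp del: mult_Homeo_c)
  then have "h \<circ> ?k' = ?k' \<circ> h"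
    using conj hk Homeo_c.commutator_subgroup_trivial_iff[OF H, of "conjugate Homeo_c t H"]
    by (simp add: conjugate_eq)
  then have "h 1 = 1"
    using Sup_moved[OF h k' k'_id] Sup_k' by metis
  \<comment> \<open>In fact \<open>h 1 = 7 / 4\<close>.\<close>
  then show False by (simp add: h_def push_def)
qed

theorem proposition3p5:
  shows "commuting_Z_conjugates Homeo_c \<and>
    (\<forall>n::nat. 2 \<le> n \<longrightarrow> \<not> commuting_Zmod_conjugates Homeo_c n)"
  using commuting_Z_conjugates_Homeo_c not_commuting_Zmod_conjugates_Homeo_c by blast

end
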